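(* Let $c\in\mathrm{Imm}(I,\mathbb{C})/\mathrm{Tra}$. Then (i) $F_{1,1/2}(c)=\dfrac{c'}{|c'|^{1/2}}$ (the square-root velocity transform); (ii) $F_{1/2,1/2}(c)=\sqrt{c'}$ (the complex square-root transform); (iii) for all parameters with $2b\ge a>0$, $R_{a,b}(c)=p_{a,b}(F_{a,b}(c))$.
   Context: $I=[0,1]$, $\mathbb{C}^\ast=\mathbb{C}\setminus\{0\}$, and $\mathbb{R}^2$ is identified with $\mathbb{C}$. $\mathrm{Imm}(I,\mathbb{C})=\{c\in C^\infty(I,\mathbb{C}) : c'(t)\neq 0 \text{ for all } t\in I\}$, and $\mathrm{Imm}(I,\mathbb{C})/\mathrm{Tra}$ is identified with the set of such $c$ with $c(0)=0$. For $a,b>0$, $F_{a,b}(c)=2b\,|c'|^{1/2}\left(\frac{c'}{|c'|}\right)^{\frac{a}{2b}}$ pointwise. Writing $c'=r\exp(i\theta)$ with $r=|c'|$ and $\theta:I\to\mathbb{R}$ continuous (unique up to an additive constant in $2\pi\mathbb{Z}$), this means $F_{a,b}(c)=2b\,r^{1/2}\exp\left(i\theta\frac{a}{2b}\right)$, which is in general multivalued because of the choice of $\theta$. In (ii), $\sqrt{c'}$ is a continuous pointwise complex square root, namely $r^{1/2}\exp(i\theta/2)$ for the same choice of $\theta$. For $2b\ge a>0$, the transform $R_{a,b}:\mathrm{Imm}(I,\mathbb{R}^2)/\mathrm{Tra}\to C^\infty(I,\mathbb{R}^3)$ is $$R_{a,b}(c)=|c'|^{1/2}\left(a\begin{pmatrix}T\\0\end{pmatrix}+\sqrt{4b^2-a^2}\begin{pmatrix}0\\1\end{pmatrix}\right),\qquad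 T=\frac{c'}{|c'|}.$$ With $\mathbb{R}^3\cong\mathbb{C}\times\mathbb{R}$, the map $p_{a,b}$ is applied pointwise to $w\in C^\infty(I,\mathbb{C}^\ast)$ by $$w\mapsto\left(\frac{a|w|}{2b}\left(\frac{w}{|w|}\right)^{2b/a},\ \frac{\sqrt{4b^2-a^2}}{2b}|w|\right),$$ where for $w=|w|\exp(i\varphi)$ with $\varphi$ continuous, $(w/|w|)^{2b/a}=\exp(i\frac{2b}{a}\varphi)$. In (iii), for $w=F_{a,b}(c)$ the continuous argument is the one used in defining $F_{a,b}(c)$, namely $\varphi=\frac{a}{2b}\theta$. *)

theory Defs
  imports "HOL-Analysis.Analysis"
begin

text \<open>
  Curves on the unit interval are functions on \<^typ>\<open>real\<close> whose values outside
  \<open>{0..1}\<close> are irrelevant; accordingly, equality of curves is stated pointwise on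
  \<open>{0..1}\<close>.  Derivatives are taken within the interval, so they are one-sided at \<open>0\<close> and \<open>1\<close>.
\<close>

definition velocity :: "(real \<Rightarrow> complex) \<Rightarrow> real \<Rightarrow> complex" where
  "velocity c t = vector_derivative c (at t within {0..1})"

definition smooth_curve :: "(real \<Rightarrow> complex) \<Rightarrow> bool" where
  "smooth_curve c \<longleftrightarrow> (\<forall>n. (velocity ^^ n) c differentiable_on {0..1})"

definition Imm :: "(real \<Rightarrow> complex) set" where
  "Imm = {c. smooth_curve c \<and> (\<forall>t\<in>{0..1}. velocity c t \<noteq> 0)}"

text \<open>Each class modulo translations is represented by its member starting at the origin.\<close>

definition Imm_mod_Tra :: "(real \<Rightarrow> complex) set" where
  "Imm_mod_Tra = {c \<in> Imm. c 0 = 0}"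

definition continuous_argument :: "(real \<Rightarrow> complex) \<Rightarrow> (real \<Rightarrow> real) \<Rightarrow> bool" where
  "continuous_argument f \<theta> \<longleftrightarrow> continuous_on {0..1} \<theta> \<and>
     (\<forall>t\<in>{0..1}. f t \<noteq> 0 \<and> f t = of_real (norm (f t)) * exp (\<i> * of_real (\<theta> t)))"

text \<open>
  The maps \<open>F\<close> and \<open>p\<close> below depend on a choice of continuous argument (of the velocity and of
  the curve \<open>w\<close>, respectively), which is passed explicitly.
\<close>

definition F_transform ::
    "real \<Rightarrow> real \<Rightarrow> (real \<Rightarrow> real) \<Rightarrow> (real \<Rightarrow> complex) \<Rightarrow> real \<Rightarrow> complex" where
  "F_transform a b \<theta> c t =
     of_real (2 * b * sqrt (norm (velocity c t))) * exp (\<i> * of_real (\<theta> t * (a / (2 * b))))"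

definition sqrt_branch :: "(real \<Rightarrow> real) \<Rightarrow> (real \<Rightarrow> complex) \<Rightarrow> real \<Rightarrow> complex" where
  "sqrt_branch \<theta> f t = of_real (sqrt (norm (f t))) * exp (\<i> * of_real (\<theta> t / 2))"

definition is_continuous_sqrt :: "(real \<Rightarrow> complex) \<Rightarrow> (real \<Rightarrow> complex) \<Rightarrow> bool" where
  "is_continuous_sqrt g f \<longleftrightarrow> continuous_on {0..1} g \<and> (\<forall>t\<in>{0..1}. (g t)\<^sup>2 = f t)"

definition unit_tangent :: "(real \<Rightarrow> complex) \<Rightarrow> real \<Rightarrow> complex" where
  "unit_tangent c t = velocity c t / of_real (norm (velocity c t))"

text \<open>Three-dimensional space is \<^typ>\<open>complex \<times> real\<close>.\<close>

definition R_transform ::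
    "real \<Rightarrow> real \<Rightarrow> (real \<Rightarrow> complex) \<Rightarrow> real \<Rightarrow> complex \<times> real" where
  "R_transform a b c t =
     sqrt (norm (velocity c t)) *\<^sub>R
       (a *\<^sub>R (unit_tangent c t, 0) + sqrt (4 * b\<^sup>2 - a\<^sup>2) *\<^sub>R (0, 1))"

definition p_map ::
    "real \<Rightarrow> real \<Rightarrow> (real \<Rightarrow> real) \<Rightarrow> (real \<Rightarrow> complex) \<Rightarrow> real \<Rightarrow> complex \<times> real" where
  "p_map a b \<phi> w t =
     (of_real (a * norm (w t) / (2 * b)) * exp (\<i> * of_real (2 * b / a * \<phi> t)),
      sqrt (4 * b\<^sup>2 - a\<^sup>2) / (2 * b) * norm (w t))"

end

theory Submission
  imports Defs
begin

text \<open>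
  A velocity that never vanishes is a continuous path in the punctured plane, and since the
  interval is contractible it has a continuous logarithm; the imaginary part of that logarithm is
  a continuous argument \<open>\<theta>\<close> (\<open>continuous_argument_exists\<close>).  Once \<open>\<theta>\<close> is chosen, everything happens pointwise in the polar
  form \<open>c' = r exp (\<i> \<theta>)\<close>.  The curve \<open>F\<close> then has modulus \<open>2 b sqrt r\<close> and argument
  \<open>a \<theta> / (2 b)\<close>.  For \<open>b = 1/2\<close> its modulus is \<open>sqrt r\<close>, and its argument is \<open>\<theta>\<close> or \<open>\<theta> / 2\<close>
  according to whether \<open>a = 1\<close> or \<open>a = 1/2\<close>, which gives the two square-root transforms.
  The power \<open>2 b / a\<close> in \<open>p\<close> undoes the scaling of the argument, so it returns
  the unit tangent \<open>exp (\<i> \<theta>)\<close>, while the factor \<open>1 / (2 b)\<close> undoes the scaling of the modulus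
  (\<open>R_transform_eq_p_map_F_transform\<close>).
\<close>

lemma continuous_on_velocity_Imm:
  assumes "c \<in> Imm"
  shows "continuous_on {0..1} (velocity c)"
proof -
  have "(velocity ^^ 1) c differentiable_on {0..1}"
    using assms unfolding Imm_def smooth_curve_def by blast
  then show ?thesis
    by (simp add: differentiable_imp_continuous_on)
qed

lemma continuous_argument_exists:
  assumes "continuous_on {0..1} f" and "\<And>t. t \<in> {0..1} \<Longrightarrow> f t \<noteq> 0"
  shows "\<exists>\<theta>. continuous_argument f \<theta>"
proof -
  have "contractible {0..1::real}"
    by (simp add: convex_imp_contractible)
  then obtain g where g: "continuous_on {0..1} g" "\<And>t. t \<in> {0..1} \<Longrightarrow> f t = exp (g t)"
    using continuous_logarithm_on_contractible[of "{0..1}" f] assms by metis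
  have "f t = of_real (norm (f t)) * exp (\<i> * of_real (Im (g t)))" if "t \<in> {0..1}" for t
    using g(2)[OF that] exp_eq_polar[of "g t"] by (simp add: cis_conv_exp norm_mult)
  then have "continuous_argument f (\<lambda>t. Im (g t))"
    using g(1) assms(2) unfolding continuous_argument_def
    by (auto intro!: continuous_intros)
  then show ?thesis by blast
qed

text \<open>
  The unit factor of a continuous polar form is \<open>f / norm f\<close>, so the given argument may be used
  wherever the direction of the curve is needed.
\<close>

lemma continuous_argument_direction:
  assumes "continuous_argument f \<theta>" and "t \<in> {0..1}"
  shows "f t / of_real (norm (f t)) = exp (\<i> * of_real (\<theta> t))"
proof -
  have nz: "f t \<noteq> 0" and polar: "f t = of_real (norm (f t)) * exp (\<i> * of_real (\<theta> t))"
    using assms unfolding continuous_argument_def by blast+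
  have "f t / of_real (norm (f t)) = of_real (norm (f t)) * exp (\<i> * of_real (\<theta> t)) / of_real (norm (f t))"
    using polar by simp
  then show ?thesis
    using nz by simp
qed

lemma continuous_argument_direction_sqrt:
  assumes "continuous_argument f \<theta>" and "t \<in> {0..1}"
  shows "f t / of_real (sqrt (norm (f t))) = of_real (sqrt (norm (f t))) * exp (\<i> * of_real (\<theta> t))"
proof -
  have nz: "f t \<noteq> 0"
    using assms unfolding continuous_argument_def by blast
  have split: "complex_of_real (norm (f t)) = of_real (sqrt (norm (f t))) * of_real (sqrt (norm (f t)))"
    by (simp flip: of_real_mult)
  show ?thesis
    unfolding continuous_argument_direction[OF assms, symmetric] split using nz by simp
qed

lemma is_continuous_sqrt_sqrt_branch:
  assumes "continuous_argument f \<theta>" and "continuous_on {0..1} f"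
  shows "is_continuous_sqrt (sqrt_branch \<theta> f) f"
  unfolding is_continuous_sqrt_def
proof
  have "continuous_on {0..1} \<theta>"
    using assms(1) unfolding continuous_argument_def by blast
  then have "continuous_on {0..1}
      (\<lambda>t. complex_of_real (sqrt (norm (f t))) * exp (\<i> * of_real (\<theta> t / 2)))"
    using assms(2) by (intro continuous_intros) auto
  then show "continuous_on {0..1} (sqrt_branch \<theta> f)"
    unfolding sqrt_branch_def[abs_def] .
  show "\<forall>t\<in>{0..1}. (sqrt_branch \<theta> f t)\<^sup>2 = f t"
  proof
    fix t :: real assume t: "t \<in> {0..1}"
    have "(exp (\<i> * of_real (\<theta> t / 2)))\<^sup>2 = exp (\<i> * of_real (\<theta> t))"
      by (simp flip: exp_double)
    moreover have "(complex_of_real (sqrt (norm (f t))))\<^sup>2 = of_real (norm (f t))"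
      by (simp flip: of_real_power)
    ultimately show "(sqrt_branch \<theta> f t)\<^sup>2 = f t"
      using assms(1) t unfolding sqrt_branch_def continuous_argument_def
      by (simp add: power_mult_distrib)
  qed
qed

lemma norm_F_transform:
  assumes "b > 0"
  shows "norm (F_transform a b \<theta> c t) = 2 * b * sqrt (norm (velocity c t))"
  using assms by (simp add: F_transform_def norm_mult)

lemma continuous_argument_F_transform:
  assumes "continuous_argument (velocity c) \<theta>" and "b > 0"
  shows "continuous_argument (F_transform a b \<theta> c) (\<lambda>t. a / (2 * b) * \<theta> t)"
  unfolding continuous_argument_def
proof (intro conjI ballI)
  show "continuous_on {0..1} (\<lambda>t. a / (2 * b) * \<theta> t)"
    using assms(1) unfolding continuous_argument_def by (intro continuous_intros) auto
next
  fix t :: real assume "t \<in> {0..1}"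
  then have "velocity c t \<noteq> 0"
    using assms(1) unfolding continuous_argument_def by blast
  then show "F_transform a b \<theta> c t \<noteq> 0"
    using assms(2) by (simp add: F_transform_def)
next
  fix t :: real
  have "\<theta> t * (a / (2 * b)) = a / (2 * b) * \<theta> t"
    by (rule mult.commute)
  then have "F_transform a b \<theta> c t =
      of_real (2 * b * sqrt (norm (velocity c t))) * exp (\<i> * of_real (a / (2 * b) * \<theta> t))"
    unfolding F_transform_def by (rule arg_cong)
  then show "F_transform a b \<theta> c t =
      of_real (norm (F_transform a b \<theta> c t)) * exp (\<i> * of_real (a / (2 * b) * \<theta> t))"
    unfolding norm_F_transform[OF assms(2)] .
qed

text \<open>
  The power \<open>2 b / a\<close> would be ambiguous for a curve known only by its values.  Using for \<open>F\<close> the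
  argument \<open>a \<theta> / (2 b)\<close> it was built from makes the powers compose to exactly \<open>\<theta>\<close>, whichever
  continuous argument \<open>\<theta>\<close> was chosen.
\<close>

lemma R_transform_eq_p_map_F_transform:
  assumes "continuous_argument (velocity c) \<theta>" and "t \<in> {0..1}" and "a > 0" and "b > 0"
  shows "R_transform a b c t
           = p_map a b (\<lambda>t. a / (2 * b) * \<theta> t) (F_transform a b \<theta> c) t"
proof -
  have arg: "2 * b / a * (a / (2 * b) * \<theta> t) = \<theta> t"
    using assms(3,4) by simp
  have dir: "unit_tangent c t = exp (\<i> * of_real (\<theta> t))"
    unfolding unit_tangent_def by (rule continuous_argument_direction[OF assms(1,2)])
  show ?thesis
    unfolding R_transform_def p_map_def norm_F_transform[OF assms(4)] arg dir
    using assms(4) by (simp add: scaleR_conv_of_real)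
qed

theorem mainTheorem4:
  fixes c :: "real \<Rightarrow> complex"
  assumes "c \<in> Imm_mod_Tra"
  shows "(\<exists>\<theta>. continuous_argument (velocity c) \<theta>) \<and>
    (\<forall>\<theta>. continuous_argument (velocity c) \<theta> \<longrightarrow>
      (\<forall>t\<in>{0..1}. F_transform 1 (1/2) \<theta> c t
          = velocity c t / of_real (sqrt (norm (velocity c t)))) \<and>
      (is_continuous_sqrt (sqrt_branch \<theta> (velocity c)) (velocity c) \<and>
       (\<forall>t\<in>{0..1}. F_transform (1/2) (1/2) \<theta> c t = sqrt_branch \<theta> (velocity c) t)) \<and>
      (\<forall>a b :: real. 2 * b \<ge> a \<and> a > 0 \<longrightarrow>
        continuous_argument (F_transform a b \<theta> c) (\<lambda>t. a / (2 * b) * \<theta> t) \<and>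
        (\<forall>t\<in>{0..1}. R_transform a b c t
            = p_map a b (\<lambda>t. a / (2 * b) * \<theta> t) (F_transform a b \<theta> c) t)))"
proof -
  have Imm: "c \<in> Imm"
    using assms unfolding Imm_mod_Tra_def by blast
  note cont = continuous_on_velocity_Imm[OF Imm]
  have "\<exists>\<theta>. continuous_argument (velocity c) \<theta>"
    using Imm by (intro continuous_argument_exists cont) (simp add: Imm_def)
  moreover have "F_transform 1 (1/2) \<theta> c t = velocity c t / of_real (sqrt (norm (velocity c t)))"
    if "continuous_argument (velocity c) \<theta>" "t \<in> {0..1}" for \<theta> t
    unfolding continuous_argument_direction_sqrt[OF that] by (simp add: F_transform_def)
  moreover have "F_transform (1/2) (1/2) \<theta> c t = sqrt_branch \<theta> (velocity c) t" for \<theta> t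
    by (simp add: F_transform_def sqrt_branch_def)
  moreover have "continuous_argument (F_transform a b \<theta> c) (\<lambda>t. a / (2 * b) * \<theta> t) \<and>
      (\<forall>t\<in>{0..1}. R_transform a b c t
        = p_map a b (\<lambda>t. a / (2 * b) * \<theta> t) (F_transform a b \<theta> c) t)"
    if "continuous_argument (velocity c) \<theta>" "2 * b \<ge> a \<and> a > 0" for \<theta> and a b :: real
  proof -
    have "a > 0" "b > 0"
      using that(2) by auto
    then show ?thesis
      using that(1) continuous_argument_F_transform R_transform_eq_p_map_F_transform by blast
  qed
  ultimately show ?thesis
    using is_continuous_sqrt_sqrt_branch[OF _ cont] by blast
qed

end
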